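(* Let $n\ge 3$ and let $(\mathbf d,\mathbf r)$, with $\mathbf d=(d_1,\dots,d_n)$ and $\mathbf r=(r_1,\dots,r_n)$, be an arithmetical structure on the cycle graph $C_n$ such that $r_i$ divides $\sum_{1\le j\le n,\ j\neq i}r_j$ for all $1\le i\le n$. Then the wheel graph $W_n$ has an arithmetical structure $(\tilde{\mathbf d},\tilde{\mathbf r})$, $\tilde{\mathbf d}=(\tilde d_0,\dots,\tilde d_n)$, $\tilde{\mathbf r}=(\tilde r_0,\dots,\tilde r_n)$, given by $$\tilde d_i=\begin{cases}1 & \text{if } i=0,\\ d_i+\dfrac{\sum_{j=1}^n r_j}{r_i} & \text{if } 1\le i\le n,\end{cases}\qquad \tilde r_i=\begin{cases} r_1+r_2+\cdots+r_n & \text{if } i=0,\\ r_i & \text{otherwise.}\end{cases}$$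
   Context: $\mathbb N$ denotes the positive integers. For a finite connected simple graph $G$ with vertex set $V$ and adjacency matrix $A$, an arithmetical structure on $G$ is a pair $(\mathbf d,\mathbf r)\in\mathbb N^V\times\mathbb N^V$ such that the gcd of the entries of $\mathbf r$ is $1$ and $(\operatorname{diag}(\mathbf d)-A)\mathbf r=0$, i.e. $d_vr_v=\sum_{u\sim v}r_u$ for every vertex $v$. The cycle $C_n$ ($n\ge3$) has vertices $v_1,\dots,v_n$ with $v_i$ adjacent to $v_{i+1}$ (indices mod $n$). The wheel graph $W_n$ is obtained from $C_n$ by adding a central vertex $v_0$ adjacent to all of $v_1,\dots,v_n$. Entries with index $i$ belong to $v_i$. *)

theory Defs
  imports "Graph_Theory.Digraph_Component"
begin

text \<open>
  Simple graphs are symmetric loop-free digraphs without parallel arcs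
  (\<^locale>\<open>pair_graph\<close>); an edge is represented by its two opposite arcs.
\<close>

text \<open>
  The vertices are \<open>1, \<dots>, n\<close>, and \<open>u mod n + 1\<close> is the cyclic successor of \<open>u\<close>.
\<close>
definition cycle_graph :: "nat \<Rightarrow> nat pair_pre_digraph" where
  "cycle_graph n = \<lparr> pverts = {1..n},
     parcs = {(u, v). u \<in> {1..n} \<and> v \<in> {1..n} \<and> (v = u mod n + 1 \<or> u = v mod n + 1)} \<rparr>"

definition wheel_graph :: "nat \<Rightarrow> nat pair_pre_digraph" where
  "wheel_graph n = \<lparr> pverts = insert 0 (pverts (cycle_graph n)),
     parcs = parcs (cycle_graph n) \<union>
       {0} \<times> pverts (cycle_graph n) \<union> pverts (cycle_graph n) \<times> {0} \<rparr>"

text \<open>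
  Matrices are indexed by vertices; only entries at vertices of the graph are ever used.
\<close>
definition adjacency_matrix :: "'a pair_pre_digraph \<Rightarrow> 'a \<Rightarrow> 'a \<Rightarrow> int" where
  "adjacency_matrix G u v = of_bool ((u, v) \<in> parcs G)"

definition diag :: "('a \<Rightarrow> nat) \<Rightarrow> 'a \<Rightarrow> 'a \<Rightarrow> int" where
  "diag d u v = (if u = v then int (d u) else 0)"

text \<open>
  The definition is meant for finite connected simple graphs. Values of \<open>d\<close> and \<open>r\<close> outside
  the vertex set are irrelevant, so functions on the whole type stand for vectors indexed by
  vertices.
\<close>
definition arithmetical_structure ::
    "'a pair_pre_digraph \<Rightarrow> ('a \<Rightarrow> nat) \<Rightarrow> ('a \<Rightarrow> nat) \<Rightarrow> bool" where
  "arithmetical_structure G d r \<longleftrightarrow>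
     (\<forall>v \<in> pverts G. d v > 0) \<and> (\<forall>v \<in> pverts G. r v > 0) \<and>
     Gcd (r ` pverts G) = 1 \<and>
     (\<forall>v \<in> pverts G.
        (\<Sum>u \<in> pverts G. (diag d v u - adjacency_matrix G v u) * int (r u)) = 0)"

lemma (in pair_graph) arithmetical_structure_iff:
  "arithmetical_structure G d r \<longleftrightarrow>
     (\<forall>v \<in> pverts G. d v > 0) \<and> (\<forall>v \<in> pverts G. r v > 0) \<and>
     Gcd (r ` pverts G) = 1 \<and>
     (\<forall>v \<in> pverts G. d v * r v = (\<Sum>u | (v, u) \<in> parcs G. r u))"
proof -
  have "(\<Sum>u \<in> pverts G. (diag d v u - adjacency_matrix G v u) * int (r u)) = 0 \<longleftrightarrow>
      d v * r v = (\<Sum>u | (v, u) \<in> parcs G. r u)" if v: "v \<in> pverts G" for v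
  proof -
    have "{u. (v, u) \<in> parcs G} = {u \<in> pverts G. (v, u) \<in> parcs G}"
      using in_arcsD2 by auto
    then have 1: "(\<Sum>u \<in> pverts G. adjacency_matrix G v u * int (r u)) =
        int (\<Sum>u | (v, u) \<in> parcs G. r u)"
      using pair_finite_verts
      by (auto simp: adjacency_matrix_def of_bool_def sum.inter_filter intro!: sum.cong)
    have 2: "(\<Sum>u \<in> pverts G. diag d v u * int (r u)) = int (d v * r v)"
      using v pair_finite_verts
      by (simp add: diag_def if_distrib if_distribR sum.delta cong: if_cong)
    show ?thesis
      unfolding left_diff_distrib sum_subtractf 1 2 by (simp flip: of_nat_mult of_nat_sum)
  qed
  then show ?thesis
    unfolding arithmetical_structure_def by auto
qed

lemma pair_graph_cycle_graph:
  assumes "n \<ge> 3"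
  shows "pair_graph (cycle_graph n)"
proof
  show "finite (parcs (cycle_graph n))"
    by (rule finite_subset[of _ "{1..n} \<times> {1..n}"]) (auto simp: cycle_graph_def)
  show "fst e \<noteq> snd e" if "e \<in> parcs (cycle_graph n)" for e
  proof -
    have "u \<noteq> u mod n + 1" if "u \<in> {1..n}" for u
      using that assms by (cases "u = n") auto
    then show ?thesis using that by (cases e) (simp add: cycle_graph_def, metis)
  qed
qed (auto simp: cycle_graph_def symmetric_def sym_def)

lemma pair_graph_wheel_graph:
  assumes "n \<ge> 3"
  shows "pair_graph (wheel_graph n)"
proof -
  interpret C: pair_graph "cycle_graph n" by (rule pair_graph_cycle_graph[OF assms])
  have 0: "0 \<notin> pverts (cycle_graph n)" by (simp add: cycle_graph_def)
  show ?thesis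
  proof
    show "finite (parcs (wheel_graph n))"
      using C.pair_finite_arcs C.pair_finite_verts by (simp add: wheel_graph_def)
    show "finite (pverts (wheel_graph n))"
      using C.pair_finite_verts by (simp add: wheel_graph_def)
    show "fst e \<noteq> snd e" if "e \<in> parcs (wheel_graph n)" for e
      using that 0 C.pair_no_loops by (auto simp: wheel_graph_def)
    show "symmetric (with_proj (wheel_graph n))"
      using C.pair_sym_arcs by (auto simp: wheel_graph_def symmetric_def sym_def)
  qed (auto simp: wheel_graph_def dest: C.in_arcsD1 C.in_arcsD2)
qed

lemma connected_cycle_graph:
  assumes "n \<ge> 3"
  shows "connected (cycle_graph n)"
proof -
  interpret C: pair_graph "cycle_graph n" by (rule pair_graph_cycle_graph[OF assms])
  have r1: "1 \<rightarrow>\<^sup>*\<^bsub>with_proj (cycle_graph n)\<^esub> k" if "1 \<le> k" "k \<le> n" for k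
    using that
  proof (induction k rule: dec_induct)
    case base
    then show ?case by (intro C.reachable_refl) (auto simp: cycle_graph_def)
  next
    case (step k)
    then have "(k, Suc k) \<in> parcs (cycle_graph n)" by (auto simp: cycle_graph_def)
    with step show ?case using C.reachable_adj_trans by fastforce
  qed
  have "strongly_connected (cycle_graph n)"
  proof
    show "verts (with_proj (cycle_graph n)) \<noteq> {}" using assms by (simp add: cycle_graph_def)
    fix u v
    assume "u \<in> verts (with_proj (cycle_graph n))" "v \<in> verts (with_proj (cycle_graph n))"
    then have "1 \<rightarrow>\<^sup>*\<^bsub>with_proj (cycle_graph n)\<^esub> u" "1 \<rightarrow>\<^sup>*\<^bsub>with_proj (cycle_graph n)\<^esub> v"
      using r1 by (auto simp: cycle_graph_def)
    then show "u \<rightarrow>\<^sup>*\<^bsub>with_proj (cycle_graph n)\<^esub> v"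
      using symmetric_reachable[OF C.pair_sym_arcs] C.reachable_trans by blast
  qed
  then show ?thesis
    using C.reachable_mk_symmetricI
    by (auto simp: connected_def strongly_connected_def mk_symmetric_def)
qed

lemma connected_wheel_graph:
  assumes "n \<ge> 3"
  shows "connected (wheel_graph n)"
proof -
  interpret W: pair_graph "wheel_graph n" by (rule pair_graph_wheel_graph[OF assms])
  have r0: "0 \<rightarrow>\<^sup>*\<^bsub>with_proj (wheel_graph n)\<^esub> k" if "k \<in> pverts (wheel_graph n)" for k
  proof (cases "k = 0")
    case True
    with that show ?thesis by simp
  next
    case False
    with that have "(0, k) \<in> parcs (wheel_graph n)" by (auto simp: wheel_graph_def)
    then show ?thesis by (intro W.reachable_adjI) simp
  qed
  have "strongly_connected (wheel_graph n)"
  proof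
    show "verts (with_proj (wheel_graph n)) \<noteq> {}" by (simp add: wheel_graph_def)
    fix u v
    assume "u \<in> verts (with_proj (wheel_graph n))" "v \<in> verts (with_proj (wheel_graph n))"
    then show "u \<rightarrow>\<^sup>*\<^bsub>with_proj (wheel_graph n)\<^esub> v"
      using r0 symmetric_reachable[OF W.pair_sym_arcs] W.reachable_trans
      by (metis with_proj_simps(1))
  qed
  then show ?thesis
    using W.reachable_mk_symmetricI
    by (auto simp: connected_def strongly_connected_def mk_symmetric_def)
qed

end

theory Submission
  imports Defs
begin

text \<open>
  Let \<open>S = r\<^sub>1 + \<dots> + r\<^sub>n\<close>. A rim vertex \<open>v\<close> of the wheel has, besides its neighbours on the cycle,
  only the hub, which carries \<open>S\<close>; its neighbour sum thus grows from \<open>d\<^sub>v r\<^sub>v\<close> to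
  \<open>d\<^sub>v r\<^sub>v + S\<close>, which is \<open>(d\<^sub>v + S/r\<^sub>v) r\<^sub>v\<close>. The quotient is an integer because \<open>r\<^sub>v\<close> divides
  \<open>S - r\<^sub>v\<close>, hence \<open>S\<close>. The hub is adjacent to the whole rim, so its neighbour sum is \<open>S\<close>, which
  matches the value \<open>1\<close> of \<open>d\<close> there. Adding the entry \<open>S\<close> leaves the gcd equal to \<open>1\<close>.
\<close>

lemma wheel_neighbours_hub: "{u. (0, u) \<in> parcs (wheel_graph n)} = {1..n}"
  by (auto simp: wheel_graph_def cycle_graph_def)

lemma wheel_neighbours_rim:
  assumes "v \<in> {1..n}"
  shows "{u. (v, u) \<in> parcs (wheel_graph n)} = insert 0 {u. (v, u) \<in> parcs (cycle_graph n)}"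
  using assms by (auto simp: wheel_graph_def cycle_graph_def)

theorem theorem3p5:
  fixes n :: nat and d r :: "nat \<Rightarrow> nat"
  assumes "n \<ge> 3"
    and "arithmetical_structure (cycle_graph n) d r"
    and "\<And>i. i \<in> {1..n} \<Longrightarrow> r i dvd (\<Sum>j \<in> {1..n} - {i}. r j)"
  shows "arithmetical_structure (wheel_graph n)
           (\<lambda>i. if i = 0 then 1 else d i + (\<Sum>j = 1..n. r j) div r i)
           (\<lambda>i. if i = 0 then (\<Sum>j = 1..n. r j) else r i)"
proof -
  interpret C: pair_graph "cycle_graph n" by (rule pair_graph_cycle_graph[OF assms(1)])
  interpret W: pair_graph "wheel_graph n" by (rule pair_graph_wheel_graph[OF assms(1)])
  define S where "S = (\<Sum>j = 1..n. r j)"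
  let ?d = "\<lambda>i. if i = 0 then 1 else d i + S div r i"
  let ?r = "\<lambda>i. if i = 0 then S else r i"
  have rim: "pverts (cycle_graph n) = {1..n}"
    by (simp add: cycle_graph_def)
  have verts: "pverts (wheel_graph n) = insert 0 {1..n}"
    by (simp add: wheel_graph_def rim)
  have d_pos: "d v > 0" and r_pos: "r v > 0"
    and eq: "d v * r v = (\<Sum>u | (v, u) \<in> parcs (cycle_graph n). r u)" if "v \<in> {1..n}" for v
    using assms(2) that unfolding C.arithmetical_structure_iff rim by auto
  have gcd_r: "Gcd (r ` {1..n}) = 1"
    using assms(2) unfolding C.arithmetical_structure_iff rim by blast
  have "S > 0"
    unfolding S_def using assms(1) r_pos by (intro sum_pos) auto
  have "?r ` insert 0 {1..n} = insert S (r ` {1..n})"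
    by auto
  then have gcd_wheel: "Gcd (?r ` insert 0 {1..n}) = 1"
    using gcd_r by simp
  have hub: "?d 0 * ?r 0 = (\<Sum>u | (0, u) \<in> parcs (wheel_graph n). ?r u)"
    unfolding wheel_neighbours_hub by (simp add: S_def)
  have rim_eq: "?d v * ?r v = (\<Sum>u | (v, u) \<in> parcs (wheel_graph n). ?r u)"
    if v: "v \<in> {1..n}" for v
  proof -
    let ?N = "{u. (v, u) \<in> parcs (cycle_graph n)}"
    have N: "?N \<subseteq> {1..n}"
      by (auto simp: cycle_graph_def)
    have "S = r v + (\<Sum>j \<in> {1..n} - {v}. r j)"
      unfolding S_def using v by (intro sum.remove) auto
    then have "r v dvd S"
      using assms(3)[OF v] by simp
    then have "?d v * ?r v = S + d v * r v"
      using v by (simp add: algebra_simps)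
    also have "\<dots> = S + (\<Sum>u \<in> ?N. ?r u)"
      unfolding eq[OF v] using N by (intro arg_cong[where f = "(+) S"] sum.cong) auto
    also have "\<dots> = (\<Sum>u \<in> insert 0 ?N. ?r u)"
      using N finite_subset[OF N] by (subst sum.insert) auto
    finally show ?thesis
      unfolding wheel_neighbours_rim[OF v] .
  qed
  have "arithmetical_structure (wheel_graph n) ?d ?r"
    unfolding W.arithmetical_structure_iff verts
  proof (intro conjI)
    show "\<forall>v \<in> insert 0 {1..n}. ?d v > 0" using d_pos by auto
    show "\<forall>v \<in> insert 0 {1..n}. ?r v > 0" using r_pos \<open>S > 0\<close> by auto
    show "Gcd (?r ` insert 0 {1..n}) = 1" by (rule gcd_wheel)
    show "\<forall>v \<in> insert 0 {1..n}. ?d v * ?r v = (\<Sum>u | (v, u) \<in> parcs (wheel_graph n). ?r u)"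
      using hub rim_eq by blast
  qed
  then show ?thesis
    unfolding S_def .
qed

end
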